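(* Let $\varphi(z)=1+B_1z+B_2z^2+B_3z^3+\cdots$ be a Ma–Minda function on $\mathbb{D}$ (so in particular $B_1>0$ and all $B_i$ are real) such that $$16B_1^2-4B_1B_2\le7B_1^3\le5B_1^4+2B_1^2-4B_1B_2+7B_1^2B_2+8B_2^2-6B_1B_3,$$ and put $$q_1=\frac{3B_1^2+4B_2}{2B_1},\qquad q_2=\frac{B_1^3+3B_1B_2+2B_3}{2B_1}.$$ If $f\in\mathcal{C}(\varphi)$ and $(q_1,q_2)\in D_1\cup D_2\cup D_3$, then $$|T_{3,2}(f)|\le\frac1{144}\left(\frac{B_1}{2}+\frac{B_1^3+3B_1B_2+2B_3}{24}\right)\left(5B_1^4+36B_1^2+7B_1^2B_2+8B_2^2-6B_1B_3\right).$$ The bound is sharp: for every such $\varphi$ satisfying these conditions there is a function in $\mathcal{C}(\varphi)$ for which equality holds.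
   Context: $\mathbb{D}=\{z\in\mathbb{C}:|z|<1\}$. $\mathcal{S}$ is the class of univalent analytic functions $f$ on $\mathbb{D}$ of the form $f(z)=z+\sum_{n\ge2}a_nz^n$. For such $f$, $T_{3,2}(f)$ is the Toeplitz determinant $$T_{3,2}(f)=\begin{vmatrix} a_2 & a_3 & a_4 \\ a_3 & a_2 & a_3 \\ a_4 & a_3 & a_2 \end{vmatrix}.$$ A Schwarz function is an analytic $\omega:\mathbb{D}\to\mathbb{D}$ with $\omega(0)=0$. For analytic $g,h$ on $\mathbb{D}$, $g\prec h$ ($g$ is subordinate to $h$) means $g=h\circ\omega$ for some Schwarz function $\omega$. A Ma–Minda function is an analytic univalent function $\varphi$ on $\mathbb{D}$ with positive real part such that $\varphi(0)=1$, $\varphi'(0)>0$, and $\varphi(\mathbb{D})$ is symmetric with respect to the real axis and starlike with respect to $\varphi(0)=1$. Its Taylor expansion is written $\varphi(z)=1+B_1z+B_2z^2+B_3z^3+\cdots$, $B_1>0$. $\mathcal{C}(\varphi)=\{f\in\mathcal{S}: 1+zf''(z)/f'(z)\prec\varphi(z)\}$. The subsets $D_1,D_2,D_3$ of $\mathbb{R}^2$ are $D_1=\{(\mu,\nu):|\mu|\le2,\ \nu\ge1\}$, $D_2=\{(\mu,\nu):2\le|\mu|\le4,\ \nu\ge\frac1{12}(\mu^2+8)\}$, $D_3=\{(\mu,\nu):|\mu|\ge4,\ \nu\ge\frac23(|\mu|-1)\}$. *)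

theory Defs
  imports "HOL-Complex_Analysis.Complex_Analysis"
begin

abbreviation unit_disc :: "complex set" ("\<D>") where
  "\<D> \<equiv> ball 0 1"

text \<open>Functions on the disc are total functions of type \<^typ>\<open>complex \<Rightarrow> complex\<close>; only their
  values on \<^term>\<open>\<D>\<close> are ever constrained or used.\<close>

abbreviation taylor_coeff :: "(complex \<Rightarrow> complex) \<Rightarrow> nat \<Rightarrow> complex" where
  "taylor_coeff f n \<equiv> fps_nth (fps_expansion f 0) n"

definition class_S :: "(complex \<Rightarrow> complex) set" where
  "class_S = {f. f holomorphic_on \<D> \<and> inj_on f \<D> \<and> f 0 = 0 \<and> deriv f 0 = 1}"

definition toeplitz_3_2 :: "(complex \<Rightarrow> complex) \<Rightarrow> complex" where
  "toeplitz_3_2 f =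
     (let a = taylor_coeff f in
      det (vector [vector [a 2, a 3, a 4],
                   vector [a 3, a 2, a 3],
                   vector [a 4, a 3, a 2]] :: complex^3^3))"

definition schwarz_function :: "(complex \<Rightarrow> complex) \<Rightarrow> bool" where
  "schwarz_function \<omega> \<longleftrightarrow> \<omega> holomorphic_on \<D> \<and> \<omega> ` \<D> \<subseteq> \<D> \<and> \<omega> 0 = 0"

definition subordinate :: "(complex \<Rightarrow> complex) \<Rightarrow> (complex \<Rightarrow> complex) \<Rightarrow> bool"
    (infix "\<prec>\<^sub>D" 50) where
  "g \<prec>\<^sub>D h \<longleftrightarrow> (\<exists>\<omega>. schwarz_function \<omega> \<and> (\<forall>z\<in>\<D>. g z = h (\<omega> z)))"

text \<open>The library's \<^const>\<open>starlike\<close> only asserts that some centre exists, so starlikeness with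
  respect to the centre 1 is spelled out.  The condition that the complex number
  \<^term>\<open>deriv \<phi> 0\<close> is positive includes that it is real.\<close>

definition ma_minda :: "(complex \<Rightarrow> complex) \<Rightarrow> bool" where
  "ma_minda \<phi> \<longleftrightarrow>
     \<phi> holomorphic_on \<D> \<and> inj_on \<phi> \<D> \<and>
     (\<forall>z\<in>\<D>. Re (\<phi> z) > 0) \<and>
     \<phi> 0 = 1 \<and>
     deriv \<phi> 0 \<in> \<real> \<and> Re (deriv \<phi> 0) > 0 \<and>
     cnj ` (\<phi> ` \<D>) = \<phi> ` \<D> \<and>
     (\<forall>w\<in>\<phi> ` \<D>. closed_segment 1 w \<subseteq> \<phi> ` \<D>)"

definition class_C :: "(complex \<Rightarrow> complex) \<Rightarrow> (complex \<Rightarrow> complex) set" where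
  "class_C \<phi> = {f \<in> class_S. (\<lambda>z. 1 + z * deriv (deriv f) z / deriv f z) \<prec>\<^sub>D \<phi>}"

text \<open>The Taylor coefficients of a Ma--Minda function are real (lemma \<open>ma_minda_coeff_real\<close>
  below), so taking the real part here loses nothing.\<close>

definition mm_coeff :: "(complex \<Rightarrow> complex) \<Rightarrow> nat \<Rightarrow> real" where
  "mm_coeff \<phi> n = Re (taylor_coeff \<phi> n)"

lemma ma_minda_cnj:
  assumes "ma_minda \<phi>" and z: "z \<in> \<D>"
  shows "cnj (\<phi> (cnj z)) = \<phi> z"
proof -
  have hol: "\<phi> holomorphic_on \<D>" and inj: "inj_on \<phi> \<D>" and phi0: "\<phi> 0 = 1"
    and real: "deriv \<phi> 0 \<in> \<real>" and pos: "Re (deriv \<phi> 0) > 0"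
    and sym: "cnj ` (\<phi> ` \<D>) = \<phi> ` \<D>"
    using assms by (auto simp: ma_minda_def)
  define \<psi> where "\<psi> = (\<lambda>z. cnj (\<phi> (cnj z)))"
  obtain g where g: "g holomorphic_on \<phi> ` \<D>"
      and dg: "\<And>z. z \<in> \<D> \<Longrightarrow> deriv \<phi> z * deriv g (\<phi> z) = 1"
      and gphi: "\<And>z. z \<in> \<D> \<Longrightarrow> g (\<phi> z) = z"
    using holomorphic_has_inverse[OF hol _ inj] by auto
  have d\<psi>: "(\<psi> has_field_derivative cnj (deriv \<phi> (cnj w))) (at w)" if "w \<in> \<D>" for w
  proof -
    have "(\<phi> has_field_derivative deriv \<phi> (cnj w)) (at (cnj w))"
      using hol that by (intro holomorphic_derivI[of _ \<D>]) auto
    then have "((cnj \<circ> \<phi> \<circ> cnj) has_field_derivative cnj (deriv \<phi> (cnj w))) (at w)"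
      by (rule has_field_derivative_cnj_cnj)
    then show ?thesis by (simp add: \<psi>_def o_def)
  qed
  have hol\<psi>: "\<psi> holomorphic_on \<D>"
    using d\<psi> by (subst holomorphic_on_open) blast+
  have img: "\<psi> w \<in> \<phi> ` \<D>" if "w \<in> \<D>" for w
  proof -
    have "cnj w \<in> \<D>" using that by simp
    then show ?thesis unfolding \<psi>_def using sym by blast
  qed
  define h where "h = g \<circ> \<psi>"
  have holh: "h holomorphic_on \<D>"
    unfolding h_def using img by (intro holomorphic_on_compose_gen[OF hol\<psi> g]) auto
  have phih: "\<phi> (h w) = \<psi> w" and hD: "h w \<in> \<D>" if "w \<in> \<D>" for w
    using img[OF that] gphi by (auto simp: h_def)
  have h0: "h 0 = 0"
    using gphi[of 0] phi0 by (simp add: h_def \<psi>_def)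
  have "open (\<phi> ` \<D>)"
    by (rule open_mapping_thm3[OF hol _ inj]) auto
  moreover have "\<psi> 0 = \<phi> 0" by (simp add: \<psi>_def phi0)
  ultimately have "(g has_field_derivative deriv g (\<phi> 0)) (at (\<psi> 0))"
    using g by (auto intro!: holomorphic_derivI[of _ "\<phi> ` \<D>"])
  then have "(h has_field_derivative deriv g (\<phi> 0) * cnj (deriv \<phi> (cnj 0))) (at 0)"
    unfolding h_def by (intro DERIV_chain d\<psi>) auto
  moreover have "deriv g (\<phi> 0) * cnj (deriv \<phi> (cnj 0)) = 1"
    using dg[of 0] real by (simp add: Reals_cnj_iff mult.commute)
  ultimately have dh: "(h has_field_derivative 1) (at 0)" by simp
  then have dh': "deriv h 0 = 1" by (rule DERIV_imp_deriv)
  obtain \<alpha> where \<alpha>: "\<And>w. norm w < 1 \<Longrightarrow> h w = \<alpha> * w"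
    using Schwarz_Lemma(3)[OF holh h0, of 0] hD dh' by auto
  have "((\<lambda>w. \<alpha> * w) has_field_derivative 1) (at 0)"
    by (rule has_field_derivative_transform_within_open[OF dh, of \<D>]) (auto simp: \<alpha>)
  moreover have "((\<lambda>w. \<alpha> * w) has_field_derivative \<alpha>) (at 0)"
    by (auto intro!: derivative_eq_intros)
  ultimately have "\<alpha> = 1" by (rule DERIV_unique[symmetric])
  then have "h z = z" using \<alpha>[of z] z by simp
  then show ?thesis using phih[OF z] by (simp add: \<psi>_def)
qed

lemma ma_minda_coeff_real:
  assumes "ma_minda \<phi>"
  shows "taylor_coeff \<phi> n = of_real (mm_coeff \<phi> n)"
proof -
  have hol: "\<phi> holomorphic_on \<D>" using assms by (simp add: ma_minda_def)
  define F where "F = Abs_fps (\<lambda>n. cnj (taylor_coeff \<phi> n))"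
  have "(\<lambda>n. fps_nth F n * z ^ n) sums \<phi> z" if z: "z \<in> \<D>" for z
  proof -
    have "(\<lambda>n. taylor_coeff \<phi> n * cnj z ^ n) sums \<phi> (cnj z)"
      using holomorphic_power_series[OF hol, of "cnj z"] z by (simp add: fps_expansion_def)
    then have "(\<lambda>n. cnj (taylor_coeff \<phi> n * cnj z ^ n)) sums cnj (\<phi> (cnj z))"
      by (simp only: sums_cnj)
    then show ?thesis using ma_minda_cnj[OF assms z] by (simp add: F_def)
  qed
  then have "\<forall>\<^sub>F z in nhds 0. (\<lambda>n. fps_nth F n * z ^ n) sums \<phi> z"
    by (intro eventually_nhds_in_open[THEN eventually_mono, of \<D>]) auto
  then have "\<phi> has_fps_expansion F"
    by (rule has_fps_expansionI)
  then have "fps_expansion \<phi> 0 = F"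
    by (rule fps_expansion_eqI)
  then have "taylor_coeff \<phi> n = cnj (taylor_coeff \<phi> n)"
    by (metis F_def fps_nth_Abs_fps)
  then show ?thesis
    unfolding mm_coeff_def by (metis Reals_cnj_iff of_real_Re)
qed

definition D1 :: "(real \<times> real) set" where
  "D1 = {(\<mu>, \<nu>). \<bar>\<mu>\<bar> \<le> 2 \<and> \<nu> \<ge> 1}"

definition D2 :: "(real \<times> real) set" where
  "D2 = {(\<mu>, \<nu>). 2 \<le> \<bar>\<mu>\<bar> \<and> \<bar>\<mu>\<bar> \<le> 4 \<and> \<nu> \<ge> 1/12 * (\<mu>\<^sup>2 + 8)}"

definition D3 :: "(real \<times> real) set" where
  "D3 = {(\<mu>, \<nu>). \<bar>\<mu>\<bar> \<ge> 4 \<and> \<nu> \<ge> 2/3 * (\<bar>\<mu>\<bar> - 1)}"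

end

theory Submission
  imports Defs
begin

text \<open>The determinant factors as \<open>(a\<^sub>2 - a\<^sub>4) (a\<^sub>2\<^sup>2 - 2 a\<^sub>3\<^sup>2 + a\<^sub>2 a\<^sub>4)\<close>.  If
  \<open>1 + z f'' / f' = \<phi> \<circ> \<omega>\<close> with \<open>\<omega> = c\<^sub>1 z + c\<^sub>2 z\<^sup>2 + \<dots>\<close>, then \<open>a\<^sub>2, a\<^sub>3, a\<^sub>4\<close> are polynomials in
  the \<open>c\<^sub>i\<close>; in particular \<open>a\<^sub>4 = B\<^sub>1/12 (c\<^sub>3 + q\<^sub>1 c\<^sub>1 c\<^sub>2 + q\<^sub>2 c\<^sub>1\<^sup>3)\<close>, which is at most \<open>B\<^sub>1 q\<^sub>2 / 12\<close> in
  modulus by an inequality of Prokhorov and Szynal.  That inequality follows from the Schur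
  parametrisation \<open>c\<^sub>2 = (1 - |c\<^sub>1|\<^sup>2) \<zeta>\<close>, \<open>c\<^sub>3 = (1 - |c\<^sub>1|\<^sup>2) (\<kappa> - cnj c\<^sub>1 \<zeta>\<^sup>2)\<close> with
  \<open>|\<kappa>| \<le> 1 - |\<zeta>|\<^sup>2\<close>.  The second factor is estimated by the triangle inequality and
  \<open>|c\<^sub>2|, |c\<^sub>3| \<le> 1 - |c\<^sub>1|\<^sup>2\<close>.

  Both estimates are attained for \<open>\<omega> z = \<i> z\<close>.  The corresponding \<open>f\<close> is obtained by integrating
  twice, and it is univalent because a convex function is starlike and a starlike one is
  univalent.\<close>

section \<open>Inequalities for the initial coefficients of a Schwarz function\<close>

text \<open>For fixed \<open>c\<close> and \<open>|\<zeta>|\<close>, the difference of the squares of the two sides is a convex quadratic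
  polynomial in \<open>Re \<zeta>\<close>; the proof completes the square, after multiplication by \<open>\<nu>\<close> to clear
  denominators.  On the curve \<open>m\<^sup>2 = 12 \<nu> - 8\<close> the remaining term is nonnegative.\<close>

lemma prokhorov_szynal_disc:
  fixes c m \<nu> :: real and \<zeta> :: complex
  assumes c: "0 \<le> c" "c \<le> 1" and \<zeta>: "cmod \<zeta> \<le> 1" and \<nu>: "1 \<le> \<nu>" and m: "m\<^sup>2 = 12 * \<nu> - 8"
  shows "cmod (of_real (\<nu> * c^3) + of_real (c * (1 - c\<^sup>2)) * (of_real m * \<zeta> - \<zeta>\<^sup>2))
           \<le> \<nu> - (1 - c\<^sup>2) * (1 - (cmod \<zeta>)\<^sup>2)" (is "cmod ?w \<le> ?r")
proof -
  define x where "x = c\<^sup>2"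
  define u v R where "u = Re \<zeta>" and "v = Im \<zeta>" and "R = (cmod \<zeta>)\<^sup>2"
  have Ruv: "R = u\<^sup>2 + v\<^sup>2"
    by (simp add: R_def u_def v_def cmod_power2)
  have R: "0 \<le> R" "R \<le> 1"
    using \<zeta> by (auto simp: R_def power_le_one)
  have x: "0 \<le> x" "x \<le> 1"
    using c by (auto simp: x_def power_le_one)
  have Re: "Re ?w = \<nu> * c^3 + c * (1 - x) * (m * u - (u\<^sup>2 - v\<^sup>2))"
    by (simp add: u_def v_def x_def power2_eq_square)
  have Im: "Im ?w = c * (1 - x) * (m * v - 2 * u * v)"
    by (simp add: u_def v_def x_def power2_eq_square)
  have "(cmod ?w)\<^sup>2 = (\<nu> * c^3 + c * (1 - x) * (m * u - (u\<^sup>2 - v\<^sup>2)))\<^sup>2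
      + (c * (1 - x) * (m * v - 2 * u * v))\<^sup>2"
    by (simp only: cmod_power2 Re Im)
  also have "\<dots> = \<nu>\<^sup>2 * x^3 + 2 * \<nu> * x\<^sup>2 * (1 - x) * (m * u - 2 * u\<^sup>2 + R)
      + x * (1 - x)\<^sup>2 * (m\<^sup>2 * R + R\<^sup>2 - 2 * m * u * R)"
    unfolding x_def Ruv by algebra
  finally have w: "(cmod ?w)\<^sup>2 = \<dots>" .
  have r: "?r = \<nu> - (1 - x) * (1 - R)"
    by (simp add: x_def R_def)
  have "\<nu> * (?r\<^sup>2 - (cmod ?w)\<^sup>2) =
      (1 - x) * ((2 * \<nu> * x * u - m / 2 * (\<nu> * x - (1 - x) * R))\<^sup>2
        + (1 - x) * (\<nu> * (\<nu> - 1 + R)\<^sup>2 - (3 * \<nu> - 2) * R\<^sup>2 + 2 * x * (\<nu> - 1) * (\<nu> - R)\<^sup>2))"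
    unfolding w r using m by (simp add: field_simps) algebra
  also have "\<dots> \<ge> 0"
  proof -
    \<comment> \<open>At \<open>R = 1\<close> the bracket without its last term is
      \<open>\<nu>^3 - 3 * \<nu> + 2 = (\<nu> - 1)^2 * (\<nu> + 2)\<close>. Replacing
      \<open>\<nu> - 1 + R\<close> by the smaller \<open>\<nu> * R\<close> scales this value by
      \<open>R^2\<close>, which settles every \<open>R\<close> in the unit interval.\<close>
    have "\<nu> * R \<le> \<nu> - 1 + R"
      using mult_nonneg_nonneg[of "\<nu> - 1" "1 - R"] \<nu> R by (simp add: algebra_simps)
    then have "(\<nu> * R)\<^sup>2 \<le> (\<nu> - 1 + R)\<^sup>2"
      using \<nu> R by (intro power_mono) auto
    then have "\<nu> * (\<nu> * R)\<^sup>2 \<le> \<nu> * (\<nu> - 1 + R)\<^sup>2"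
      using \<nu> by (intro mult_left_mono) auto
    moreover have "\<nu> * (\<nu> * R)\<^sup>2 - (3 * \<nu> - 2) * R\<^sup>2 = (\<nu> - 1)\<^sup>2 * (\<nu> + 2) * R\<^sup>2"
      by algebra
    moreover have "0 \<le> (\<nu> - 1)\<^sup>2 * (\<nu> + 2) * R\<^sup>2"
      using \<nu> by auto
    ultimately have "0 \<le> \<nu> * (\<nu> - 1 + R)\<^sup>2 - (3 * \<nu> - 2) * R\<^sup>2"
      by linarith
    moreover have "0 \<le> 2 * x * (\<nu> - 1) * (\<nu> - R)\<^sup>2"
      using \<nu> x by auto
    ultimately show ?thesis
      using x \<nu> by (intro mult_nonneg_nonneg add_nonneg_nonneg) auto
  qed
  finally have "(cmod ?w)\<^sup>2 \<le> ?r\<^sup>2"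
    using \<nu> by (simp add: zero_le_mult_iff)
  moreover have "0 \<le> ?r"
  proof -
    have "(1 - x) * (1 - R) \<le> 1 * 1"
      using x R by (intro mult_mono) auto
    then show ?thesis
      using \<nu> by (simp add: r)
  qed
  ultimately show ?thesis
    by (rule power2_le_imp_le)
qed

text \<open>Rotation reduces to a nonnegative \<open>c1\<close>. With \<open>c1 = c * e\<close> and
  \<open>z = \<zeta> * (cnj e)^2\<close> the phase \<open>e^3\<close> comes out of everything except
  the \<open>\<kappa>\<close> term. That term is at most
  \<open>(1 - c^2) * (1 - (cmod \<zeta>)^2)\<close>, exactly the amount subtracted in
  \<open>prokhorov_szynal_disc\<close>.\<close>

lemma prokhorov_szynal_curve:
  fixes c1 c2 c3 \<zeta> \<kappa> :: complex and m \<nu> :: real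
  assumes c1: "cmod c1 \<le> 1" and \<zeta>: "cmod \<zeta> \<le> 1" and \<kappa>: "cmod \<kappa> \<le> 1 - (cmod \<zeta>)\<^sup>2"
    and c2: "c2 = of_real (1 - (cmod c1)\<^sup>2) * \<zeta>"
    and c3: "c3 = of_real (1 - (cmod c1)\<^sup>2) * (\<kappa> - cnj c1 * \<zeta>\<^sup>2)"
    and \<nu>: "1 \<le> \<nu>" and m: "m\<^sup>2 = 12 * \<nu> - 8"
  shows "cmod (c3 + of_real m * c1 * c2 + of_real \<nu> * c1^3) \<le> \<nu>"
proof -
  define c where "c = cmod c1"
  \<comment> \<open>Since \<open>sgn 0 = 0\<close>, the phase of \<open>c1 = 0\<close> is set to 1
    to keep \<open>e\<close> unimodular.\<close>
  define e where "e = (if c1 = 0 then 1 else sgn c1)"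
  have e: "cmod e = 1" "c1 = of_real c * e"
    by (simp_all add: e_def c_def norm_sgn) (simp add: sgn_div_norm scaleR_conv_of_real)
  have ee: "e * cnj e = 1"
    using e by (simp add: complex_norm_square[symmetric])
  define z where "z = \<zeta> * (cnj e)\<^sup>2"
  have cz: "cmod z = cmod \<zeta>"
    using e by (simp add: z_def norm_mult norm_power)
  let ?W = "of_real (\<nu> * c^3) + of_real (c * (1 - c\<^sup>2)) * (of_real m * z - z\<^sup>2) :: complex"
  have "c3 + of_real m * c1 * c2 + of_real \<nu> * c1^3 = of_real (1 - c\<^sup>2) * \<kappa> + e^3 * ?W"
    unfolding c2 c3 c_def[symmetric] unfolding e(2) z_def
    using ee by simp algebra
  also have "cmod \<dots> \<le> cmod (of_real (1 - c\<^sup>2) * \<kappa>) + cmod (e^3 * ?W)"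
    by (rule norm_triangle_ineq)
  also have "cmod (of_real (1 - c\<^sup>2) * \<kappa>) \<le> (1 - c\<^sup>2) * (1 - (cmod \<zeta>)\<^sup>2)"
  proof -
    have "0 \<le> 1 - c\<^sup>2"
      using c1 by (simp add: c_def power_le_one)
    then show ?thesis
      unfolding norm_mult norm_of_real using \<kappa> by (simp add: mult_left_mono)
  qed
  also have "cmod (e^3 * ?W) \<le> \<nu> - (1 - c\<^sup>2) * (1 - (cmod \<zeta>)\<^sup>2)"
    using prokhorov_szynal_disc[of c z \<nu> m] c1 \<zeta> \<nu> m e(1)
    unfolding norm_mult norm_power cz by (simp add: c_def)
  finally show ?thesis by simp
qed

text \<open>The left-hand side is a convex function of \<open>(\<mu>, \<nu>)\<close>, so the curve suffices: \<open>D1\<close> is reduced to the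
  points \<open>(\<plusminus>2, 1)\<close>, and \<open>D3\<close> to \<open>(\<plusminus>4, 2)\<close> plus multiples of the direction \<open>(\<plusminus>1, 2/3)\<close>.\<close>

lemma prokhorov_szynal:
  fixes c1 c2 c3 \<zeta> \<kappa> :: complex and \<mu> \<nu> :: real
  assumes c1: "cmod c1 \<le> 1" and \<zeta>: "cmod \<zeta> \<le> 1" and \<kappa>: "cmod \<kappa> \<le> 1 - (cmod \<zeta>)\<^sup>2"
    and c2: "c2 = of_real (1 - (cmod c1)\<^sup>2) * \<zeta>"
    and c3: "c3 = of_real (1 - (cmod c1)\<^sup>2) * (\<kappa> - cnj c1 * \<zeta>\<^sup>2)"
    and D: "(\<mu>, \<nu>) \<in> D1 \<union> D2 \<union> D3"
  shows "cmod (c3 + of_real \<mu> * c1 * c2 + of_real \<nu> * c1^3) \<le> \<nu>"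
proof -
  let ?\<Psi> = "\<lambda>m n. c3 + of_real m * c1 * c2 + of_real n * c1^3"
  note curve = prokhorov_szynal_curve[OF c1 \<zeta> \<kappa> c2 c3]
  \<comment> \<open>Raising \<open>n'\<close> to \<open>n\<close> adds at most
    \<open>(n - n') * cmod c1 ^ 3\<close>, hence at most \<open>n - n'\<close>, to the left-hand
    side. Only the lower boundary of each region remains.\<close>
  have mono: "cmod (?\<Psi> m n) \<le> n" if "cmod (?\<Psi> m n') \<le> n'" "n' \<le> n" for m n n'
  proof -
    have "?\<Psi> m n = ?\<Psi> m n' + of_real (n - n') * c1^3"
      by (simp add: algebra_simps)
    also have "cmod \<dots> \<le> cmod (?\<Psi> m n') + cmod (of_real (n - n') * c1^3)"
      by (rule norm_triangle_ineq)
    also have "cmod (of_real (n - n') * c1^3) = (n - n') * cmod c1 ^ 3"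
      using that by (simp only: norm_mult norm_power norm_of_real abs_of_nonneg diff_ge_0_iff_ge)
    also have "\<dots> \<le> (n - n') * 1"
      using that c1 by (intro mult_left_mono power_le_one) auto
    finally show ?thesis using that by simp
  qed
  from D consider "(\<mu>, \<nu>) \<in> D1" | "(\<mu>, \<nu>) \<in> D2" | "(\<mu>, \<nu>) \<in> D3" by blast
  then show ?thesis
  proof cases
    case 1
    then have \<mu>: "\<bar>\<mu>\<bar> \<le> 2" and \<nu>: "1 \<le> \<nu>" by (auto simp: D1_def)
    have "?\<Psi> \<mu> 1 = of_real ((2 + \<mu>) / 4) * ?\<Psi> 2 1 + of_real ((2 - \<mu>) / 4) * ?\<Psi> (-2) 1"
      by (simp add: field_simps)
    also have "cmod \<dots> \<le> \<bar>(2 + \<mu>) / 4\<bar> * cmod (?\<Psi> 2 1) + \<bar>(2 - \<mu>) / 4\<bar> * cmod (?\<Psi> (-2) 1)"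
      by (rule norm_triangle_le) (simp only: norm_mult norm_of_real)
    also have "\<dots> \<le> \<bar>(2 + \<mu>) / 4\<bar> * 1 + \<bar>(2 - \<mu>) / 4\<bar> * 1"
      using curve[of 1 2] curve[of 1 "-2"] by (intro add_mono mult_left_mono) auto
    also have "\<dots> = 1" using \<mu> by (simp add: abs_le_iff field_simps)
    finally show ?thesis using mono[of \<mu> 1 \<nu>] \<nu> by blast
  next
    case 2
    then have \<mu>: "2 \<le> \<bar>\<mu>\<bar>" and \<nu>: "(\<mu>\<^sup>2 + 8) / 12 \<le> \<nu>" by (auto simp: D2_def)
    have "4 \<le> \<mu>\<^sup>2" using power_mono[OF \<mu>, of 2] by simp
    then have "cmod (?\<Psi> \<mu> ((\<mu>\<^sup>2 + 8) / 12)) \<le> (\<mu>\<^sup>2 + 8) / 12"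
      by (intro curve) (auto simp: field_simps)
    then show ?thesis using mono \<nu> by blast
  next
    case 3
    then have \<mu>: "4 \<le> \<bar>\<mu>\<bar>" and \<nu>: "2/3 * (\<bar>\<mu>\<bar> - 1) \<le> \<nu>" by (auto simp: D3_def)
    define c where "c = cmod c1"
    define s where "s = sgn \<mu>"
    have s: "\<mu> = s * \<bar>\<mu>\<bar>" "s\<^sup>2 = 1" "\<bar>s\<bar> = 1"
      using \<mu> by (auto simp: s_def sgn_if)
    have c: "0 \<le> c" "c \<le> 1" "c\<^sup>2 \<le> 1"
      using c1 by (auto simp: c_def power_le_one)
    have "cmod c2 \<le> 1 - c\<^sup>2"
      using \<zeta> c unfolding c2 norm_mult norm_of_real by (simp add: c_def mult_left_le)
    then have "cmod (of_real s * c1 * c2 + of_real (2/3) * c1^3) \<le> c * (1 - c\<^sup>2) + 2/3 * c^3"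
      unfolding c_def
      by (intro norm_triangle_le) (auto simp: norm_mult norm_power s mult_left_mono)
    also have "\<dots> \<le> 2/3"
    proof -
      have "0 \<le> (1 - c)\<^sup>2 * (c + 2)" using c by simp
      also have "\<dots> = 3 * (2/3 - (c * (1 - c\<^sup>2) + 2/3 * c^3))" by algebra
      finally show ?thesis by simp
    qed
    finally have dir: "cmod (of_real s * c1 * c2 + of_real (2/3) * c1^3) \<le> 2/3" .
    have "?\<Psi> \<mu> (2/3 * (\<bar>\<mu>\<bar> - 1)) = ?\<Psi> (s * 4) 2
        + of_real (\<bar>\<mu>\<bar> - 4) * (of_real s * c1 * c2 + of_real (2/3) * c1^3)"
      by (subst s(1)) (simp add: field_simps)
    also have "cmod \<dots> \<le> 2 + (\<bar>\<mu>\<bar> - 4) * (2/3)"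
    proof (rule norm_triangle_mono)
      show "cmod (?\<Psi> (s * 4) 2) \<le> 2"
        by (intro curve) (auto simp: power_mult_distrib s)
      show "cmod (of_real (\<bar>\<mu>\<bar> - 4) * (of_real s * c1 * c2 + of_real (2/3) * c1^3)) \<le> (\<bar>\<mu>\<bar> - 4) * (2/3)"
        unfolding norm_mult[of "of_real (\<bar>\<mu>\<bar> - 4)"] norm_of_real using \<mu> dir
        by (simp only: abs_of_nonneg diff_ge_0_iff_ge mult_left_mono)
    qed
    also have "\<dots> = 2/3 * (\<bar>\<mu>\<bar> - 1)" by (simp add: field_simps)
    finally show ?thesis using mono \<nu> by blast
  qed
qed

lemma schur_coeff_bounds:
  fixes c1 c2 c3 \<zeta> \<kappa> :: complex
  assumes c1: "cmod c1 \<le> 1" and \<zeta>: "cmod \<zeta> \<le> 1" and \<kappa>: "cmod \<kappa> \<le> 1 - (cmod \<zeta>)\<^sup>2"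
    and c2: "c2 = of_real (1 - (cmod c1)\<^sup>2) * \<zeta>"
    and c3: "c3 = of_real (1 - (cmod c1)\<^sup>2) * (\<kappa> - cnj c1 * \<zeta>\<^sup>2)"
  shows "cmod c2 \<le> 1 - (cmod c1)\<^sup>2" and "cmod c3 \<le> 1 - (cmod c1)\<^sup>2"
proof -
  have s: "0 \<le> 1 - (cmod c1)\<^sup>2"
    using c1 by (simp add: power_le_one)
  show "cmod c2 \<le> 1 - (cmod c1)\<^sup>2"
    using \<zeta> s unfolding c2 norm_mult norm_of_real by (simp add: mult_left_le)
  have "cmod (\<kappa> - cnj c1 * \<zeta>\<^sup>2) \<le> cmod \<kappa> + cmod c1 * (cmod \<zeta>)\<^sup>2"
    by (rule order_trans[OF norm_triangle_ineq4]) (simp add: norm_mult norm_power)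
  also have "\<dots> \<le> (1 - (cmod \<zeta>)\<^sup>2) + 1 * (cmod \<zeta>)\<^sup>2"
    using c1 by (intro add_mono \<kappa> mult_right_mono) auto
  finally have "cmod (\<kappa> - cnj c1 * \<zeta>\<^sup>2) \<le> 1" by simp
  then show "cmod c3 \<le> 1 - (cmod c1)\<^sup>2"
    using s unfolding c3 norm_mult norm_of_real by (simp add: mult_left_le)
qed

text \<open>The expression is 144 times the second factor of the determinant. With
  \<open>b = B^2\<close> and \<open>x = (cmod c1)^2\<close>, the triangle inequality gives a bound
  increasing in \<open>L\<close>. Inserting the largest value \<open>L = K + 2 * b\<close> leaves
  the gap \<open>(1 - x) * (K + 22 * b - 2 * b * x)\<close>, which is nonnegative because the two
  hypotheses together force \<open>14 * b \<le> K\<close>.\<close>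

lemma second_factor_bound:
  fixes c1 c2 c3 :: complex and B K L :: real
  assumes c1: "cmod c1 \<le> 1" and c2: "cmod c2 \<le> 1 - (cmod c1)\<^sup>2" and c3: "cmod c3 \<le> 1 - (cmod c1)\<^sup>2"
    and L: "16 * B\<^sup>2 \<le> L" and K: "L \<le> K + 2 * B\<^sup>2"
  shows "cmod (of_real (36 * B\<^sup>2) * c1\<^sup>2 - of_real K * c1^4 - of_real L * c1\<^sup>2 * c2
           - of_real (8 * B\<^sup>2) * c2\<^sup>2 + of_real (6 * B\<^sup>2) * c1 * c3) \<le> 36 * B\<^sup>2 + K"
proof -
  define b where "b = B\<^sup>2"
  define x where "x = (cmod c1)\<^sup>2"
  have b: "0 \<le> b" by (simp add: b_def)
  have x: "0 \<le> x" "x \<le> 1" using c1 by (auto simp: x_def power_le_one)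
  have K0: "14 * b \<le> K" and L0: "0 \<le> L"
    using L K b unfolding b_def by linarith+
  have K': "L \<le> K + 2 * b" using K by (simp add: b_def)
  have "cmod (of_real (36 * b) * c1\<^sup>2 - of_real K * c1^4 - of_real L * c1\<^sup>2 * c2
           - of_real (8 * b) * c2\<^sup>2 + of_real (6 * b) * c1 * c3)
      \<le> cmod (of_real (36 * b) * c1\<^sup>2) + cmod (of_real K * c1^4) + cmod (of_real L * c1\<^sup>2 * c2)
           + cmod (of_real (8 * b) * c2\<^sup>2) + cmod (of_real (6 * b) * c1 * c3)"
    by (intro norm_triangle_mono norm_triangle_le_diff add_mono order_refl)
  also have "\<dots> = 36 * b * x + K * x\<^sup>2 + L * x * cmod c2 + 8 * b * (cmod c2)\<^sup>2
      + 6 * b * (cmod c1 * cmod c3)"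
    unfolding norm_mult norm_power norm_of_real x_def using b K0 L0 by simp
  also have "\<dots> \<le> 36 * b * x + K * x\<^sup>2 + L * x * (1 - x) + 8 * b * (1 - x) + 6 * b * (1 - x)"
  proof (intro add_mono mult_left_mono order_refl)
    have "cmod c2 \<le> 1"
      using c2 x(1) unfolding x_def by linarith
    then have "cmod c2 * cmod c2 \<le> cmod c2"
      by (intro mult_left_le) auto
    then show "(cmod c2)\<^sup>2 \<le> 1 - x"
      using c2 by (simp add: x_def power2_eq_square)
    show "cmod c1 * cmod c3 \<le> 1 - x"
      using c1 c3 x mult_mono[of "cmod c1" 1 "cmod c3" "1 - x"] by (simp add: x_def)
  qed (use c2 b L0 K0 x in \<open>auto simp: x_def\<close>)
  also have "\<dots> \<le> 36 * b * x + K * x\<^sup>2 + (K + 2 * b) * x * (1 - x) + 8 * b * (1 - x) + 6 * b * (1 - x)"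
    using K' x by (intro add_mono mult_right_mono order_refl) auto
  also have "\<dots> = 36 * b + K - (1 - x) * (K + 22 * b - 2 * b * x)"
    by algebra
  also have "\<dots> \<le> 36 * b + K"
  proof -
    have "b * x \<le> b * 1" using x b by (intro mult_left_mono) auto
    then have "0 \<le> (1 - x) * (K + 22 * b - 2 * b * x)"
      using x K0 b by (intro mult_nonneg_nonneg) auto
    then show ?thesis by simp
  qed
  finally show ?thesis by (simp add: b_def)
qed

section \<open>The Schur parametrisation\<close>

text \<open>The maximum modulus principle separates off the unimodular constants, for which the
  Moebius transform in \<open>schur_step\<close> degenerates.\<close>

lemma bounded_by_one_cases:
  assumes g: "g holomorphic_on \<D>" and le: "\<And>z. z \<in> \<D> \<Longrightarrow> cmod (g z) \<le> 1"
  obtains "cmod (g 0) = 1" "\<And>z. z \<in> \<D> \<Longrightarrow> g z = g 0"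
        | "\<And>z. z \<in> \<D> \<Longrightarrow> cmod (g z) < 1"
proof (cases "\<exists>w\<in>\<D>. cmod (g w) = 1")
  case True
  then obtain w where w: "w \<in> \<D>" "cmod (g w) = 1" by blast
  have "g constant_on \<D>"
  proof (rule maximum_modulus_principle[OF g _ _ _ _ w(1)])
    show "\<And>z. z \<in> \<D> \<Longrightarrow> cmod (g z) \<le> cmod (g w)" using le w by simp
  qed auto
  then have "g z = g 0" if "z \<in> \<D>" for z
    using that unfolding constant_on_def by (metis centre_in_ball zero_less_one)
  with w that(1) show ?thesis by metis
next
  case False
  then show ?thesis using le that(2) by (meson order_le_less)
qed

lemma schwarz_quotient:
  assumes "f holomorphic_on \<D>" "f 0 = 0" "\<And>z. z \<in> \<D> \<Longrightarrow> cmod (f z) < 1"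
  obtains g where "g holomorphic_on \<D>" "\<And>z. z \<in> \<D> \<Longrightarrow> cmod (g z) \<le> 1"
    "\<And>z. z \<in> \<D> \<Longrightarrow> f z = z * g z"
proof -
  obtain g where g: "g holomorphic_on \<D>" "\<And>z. cmod z < 1 \<Longrightarrow> f z = z * g z" "deriv f 0 = g 0"
    using Schwarz3[OF assms(1,2)] by metis
  have "cmod (g z) \<le> 1" if z: "z \<in> \<D>" for z
  proof (cases "z = 0")
    case True
    then show ?thesis
      using Schwarz_Lemma(2)[OF assms(1,2), of 0] assms(3) g(3) by simp
  next
    case False
    have "cmod z * cmod (g z) \<le> cmod z * 1"
      using Schwarz_Lemma(1)[OF assms(1,2), of z] assms(3) g(2)[of z] z by (simp add: norm_mult)
    then show ?thesis using False by simp
  qed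
  then show ?thesis using that g by simp
qed

text \<open>Both parts rest on small moduli; the second follows from the identity
  \<open>|1 - cnj a * w|^2 - |w - a|^2 = (1 - |a|^2) * (1 - |w|^2)\<close>.\<close>

lemma moebius_norm_less:
  fixes a w :: complex
  assumes "cmod a < 1" "cmod w < 1"
  shows "1 - cnj a * w \<noteq> 0" "cmod ((w - a) / (1 - cnj a * w)) < 1"
proof -
  have "cmod (cnj a * w) < 1 * 1"
    unfolding norm_mult using assms by (intro mult_strict_mono') auto
  then show nz: "1 - cnj a * w \<noteq> 0" by auto
  have "of_real ((cmod (1 - cnj a * w))\<^sup>2 - (cmod (w - a))\<^sup>2)
      = (of_real ((1 - (cmod a)\<^sup>2) * (1 - (cmod w)\<^sup>2)) :: complex)"
    by (simp only: of_real_diff of_real_mult complex_norm_square of_real_1) (simp add: algebra_simps)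
  then have "(cmod (1 - cnj a * w))\<^sup>2 - (cmod (w - a))\<^sup>2 = (1 - (cmod a)\<^sup>2) * (1 - (cmod w)\<^sup>2)"
    unfolding of_real_eq_iff .
  also have "\<dots> > 0"
    using assms by (simp add: power_less_one_iff)
  finally have "(cmod (w - a))\<^sup>2 < (cmod (1 - cnj a * w))\<^sup>2"
    by (simp only: diff_gt_0_iff_gt)
  then have "cmod (w - a) < cmod (1 - cnj a * w)"
    by (rule power2_less_imp_less) (rule norm_ge_zero)
  then show "cmod ((w - a) / (1 - cnj a * w)) < 1"
    using nz by (simp add: norm_divide)
qed

lemma has_fps_expansion_on_disc:
  "f holomorphic_on \<D> \<Longrightarrow> f has_fps_expansion fps_expansion f 0"
  by (rule has_fps_expansion_fps_expansion[of \<D>]) auto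

text \<open>This turns identities between functions on the disc into identities of formal power
  series, which are then read off coefficientwise.\<close>

lemma fps_expansion_unique_on_disc:
  fixes f g :: "complex \<Rightarrow> complex"
  assumes "f has_fps_expansion F" "g has_fps_expansion G" "\<And>z. z \<in> \<D> \<Longrightarrow> f z = g z"
  shows "F = G"
proof -
  have "\<forall>\<^sub>F z in nhds 0. f z = g z"
    using assms(3) by (intro eventually_nhds_in_open[THEN eventually_mono, of \<D>]) auto
  then have "g has_fps_expansion F"
    using assms(1) has_fps_expansion_cong by blast
  then show ?thesis using assms(2) fps_expansion_eqI by metis
qed

text \<open>One step of the Schur algorithm. The Moebius transform of \<open>g\<close> that sends
  \<open>a = g 0\<close> to 0 equals \<open>z * k z\<close> by the Schwarz lemma. Clearing the
  denominator gives \<open>g - a = z * k * (1 - cnj a * g)\<close>, whose coefficients of degree 1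
  and 2 are the two formulas.\<close>

lemma schur_step:
  assumes g: "g holomorphic_on \<D>" and le: "\<And>z. z \<in> \<D> \<Longrightarrow> cmod (g z) \<le> 1"
  obtains k where "k holomorphic_on \<D>" "\<And>z. z \<in> \<D> \<Longrightarrow> cmod (k z) \<le> 1"
    "taylor_coeff g 1 = of_real (1 - (cmod (g 0))\<^sup>2) * taylor_coeff k 0"
    "taylor_coeff g 2 = of_real (1 - (cmod (g 0))\<^sup>2)
       * (taylor_coeff k 1 - cnj (g 0) * (taylor_coeff k 0)\<^sup>2)"
proof -
  define a where "a = g 0"
  define G where "G = fps_expansion g 0"
  have G: "g has_fps_expansion G" unfolding G_def by (rule has_fps_expansion_on_disc[OF g])
  consider "cmod a = 1" "\<And>z. z \<in> \<D> \<Longrightarrow> g z = a" | "\<And>z. z \<in> \<D> \<Longrightarrow> cmod (g z) < 1"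
    using bounded_by_one_cases[OF g le] unfolding a_def by metis
  then show ?thesis
  proof cases
    case 1
    have "G = fps_const a"
      by (rule fps_expansion_unique_on_disc[OF G has_fps_expansion_const]) (rule 1(2))
    \<comment> \<open>For a unimodular constant all the coefficients concerned vanish, so
      \<open>k = 0\<close> serves.\<close>
    then show ?thesis
      using that[of "\<lambda>_. 0"] 1(1) unfolding G_def a_def by simp
  next
    case 2
    then have lt: "\<And>z. z \<in> \<D> \<Longrightarrow> cmod (g z) < 1" and a: "cmod a < 1" by (auto simp: a_def)
    define h where "h = (\<lambda>z. (g z - a) / (1 - cnj a * g z))"
    have h: "h holomorphic_on \<D>"
      unfolding h_def using moebius_norm_less(1)[OF a lt] by (intro holomorphic_intros g) auto
    obtain k where k: "k holomorphic_on \<D>" "\<And>z. z \<in> \<D> \<Longrightarrow> cmod (k z) \<le> 1"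
        and hk: "\<And>z. z \<in> \<D> \<Longrightarrow> h z = z * k z"
    proof -
      have "h 0 = 0" by (simp add: h_def a_def)
      moreover have "cmod (h z) < 1" if "z \<in> \<D>" for z
        unfolding h_def by (rule moebius_norm_less(2)[OF a lt[OF that]])
      ultimately show thesis using schwarz_quotient[OF h] that by metis
    qed
    define K where "K = fps_expansion k 0"
    have K: "k has_fps_expansion K" unfolding K_def by (rule has_fps_expansion_on_disc[OF k(1)])
    have "g z - a = z * k z * (1 - cnj a * g z)" if "z \<in> \<D>" for z
      using hk[OF that] moebius_norm_less(1)[OF a lt[OF that]] by (simp add: h_def field_simps)
    then have eq: "G - fps_const a = fps_X * K * (1 - fps_const (cnj a) * G)"
      by (intro fps_expansion_unique_on_disc[of "\<lambda>z. g z - a" _ "\<lambda>z. z * k z * (1 - cnj a * g z)"])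
         (auto intro!: fps_expansion_intros G K)
    have aa: "of_real (1 - (cmod a)\<^sup>2) = 1 - a * cnj a"
      by (simp only: of_real_diff of_real_1 complex_norm_square)
    have 0: "fps_nth G 0 = a"
      using has_fps_expansion_imp_0_eq_fps_nth_0[OF G] by (simp add: a_def)
    have 1: "fps_nth G 1 = fps_nth K 0 * (1 - cnj a * fps_nth G 0)"
      using arg_cong[OF eq, of "\<lambda>F. fps_nth F 1"] by (simp add: mult.assoc)
    have 2: "fps_nth G 2 = fps_nth K 1 * (1 - cnj a * fps_nth G 0)
        - fps_nth K 0 * cnj a * fps_nth G 1"
      using arg_cong[OF eq, of "\<lambda>F. fps_nth F 2"]
      by (simp add: mult.assoc fps_mult_nth numeral_2_eq_2 algebra_simps)
    have "fps_nth G 1 = (1 - a * cnj a) * fps_nth K 0"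
      using 0 1 by (simp add: mult.commute)
    moreover have "fps_nth G 2 = (1 - a * cnj a) * (fps_nth K 1 - cnj a * (fps_nth K 0)\<^sup>2)"
      unfolding 2 1 0 by algebra
    ultimately show ?thesis
      using that[OF k] unfolding a_def[symmetric] aa G_def[symmetric] K_def[symmetric] by blast
  qed
qed

text \<open>Write \<open>\<omega> z = z * g z\<close> and apply \<open>schur_step\<close> to
  \<open>g\<close>. Then \<open>\<zeta>\<close> and \<open>\<kappa>\<close> are the first two
  coefficients of the resulting \<open>k\<close>, and a further step applied to \<open>k\<close>
  bounds \<open>\<kappa>\<close>.\<close>

lemma schwarz_function_coeffs:
  assumes "schwarz_function \<omega>"
  obtains \<zeta> \<kappa> where "cmod (taylor_coeff \<omega> 1) \<le> 1" "cmod \<zeta> \<le> 1" "cmod \<kappa> \<le> 1 - (cmod \<zeta>)\<^sup>2"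
    "taylor_coeff \<omega> 2 = of_real (1 - (cmod (taylor_coeff \<omega> 1))\<^sup>2) * \<zeta>"
    "taylor_coeff \<omega> 3 = of_real (1 - (cmod (taylor_coeff \<omega> 1))\<^sup>2)
       * (\<kappa> - cnj (taylor_coeff \<omega> 1) * \<zeta>\<^sup>2)"
proof -
  have \<omega>: "\<omega> holomorphic_on \<D>" "\<omega> 0 = 0" "\<And>z. z \<in> \<D> \<Longrightarrow> cmod (\<omega> z) < 1"
    using assms by (auto simp: schwarz_function_def image_subset_iff)
  obtain g where g: "g holomorphic_on \<D>" "\<And>z. z \<in> \<D> \<Longrightarrow> cmod (g z) \<le> 1"
      and \<omega>g: "\<And>z. z \<in> \<D> \<Longrightarrow> \<omega> z = z * g z"
    using schwarz_quotient[OF \<omega>] by blast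
  have X: "fps_expansion \<omega> 0 = fps_X * fps_expansion g 0"
    by (rule fps_expansion_unique_on_disc[OF has_fps_expansion_on_disc[OF \<omega>(1)] _ \<omega>g])
       (intro fps_expansion_intros has_fps_expansion_on_disc g(1))
  have g0: "taylor_coeff g 0 = g 0"
    by (simp add: fps_expansion_def)
  obtain k where k: "k holomorphic_on \<D>" "\<And>z. z \<in> \<D> \<Longrightarrow> cmod (k z) \<le> 1"
    and gk: "taylor_coeff g 1 = of_real (1 - (cmod (g 0))\<^sup>2) * taylor_coeff k 0"
    "taylor_coeff g 2 = of_real (1 - (cmod (g 0))\<^sup>2)
       * (taylor_coeff k 1 - cnj (g 0) * (taylor_coeff k 0)\<^sup>2)"
    using schur_step[OF g] by blast
  have k0: "taylor_coeff k 0 = k 0"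
    by (simp add: fps_expansion_def)
  obtain l where l: "l holomorphic_on \<D>" "\<And>z. z \<in> \<D> \<Longrightarrow> cmod (l z) \<le> 1"
    and kl: "taylor_coeff k 1 = of_real (1 - (cmod (k 0))\<^sup>2) * taylor_coeff l 0"
    using schur_step[OF k] by blast
  have l0: "taylor_coeff l 0 = l 0"
    by (simp add: fps_expansion_def)
  have c: "taylor_coeff \<omega> 1 = g 0" "taylor_coeff \<omega> 2 = taylor_coeff g 1"
      "taylor_coeff \<omega> 3 = taylor_coeff g 2"
    using g0 by (simp_all add: X)
  show ?thesis
  proof (rule that[of "k 0" "taylor_coeff k 1"])
    have "0 \<le> 1 - (cmod (k 0))\<^sup>2"
      using k(2)[of 0] by (simp add: power_le_one)
    then show "cmod (taylor_coeff k 1) \<le> 1 - (cmod (k 0))\<^sup>2"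
      using l(2)[of 0] unfolding kl l0 norm_mult norm_of_real by (simp add: mult_left_le)
  qed (use g(2)[of 0] k(2)[of 0] in \<open>simp_all only: c gk k0 centre_in_ball zero_less_one\<close>)
qed

section \<open>Univalence of convex functions\<close>

lemma holomorphic_primitive_disc:
  assumes "f holomorphic_on \<D>"
  obtains F where "F holomorphic_on \<D>" "F 0 = 0"
    "\<And>z. z \<in> \<D> \<Longrightarrow> (F has_field_derivative f z) (at z)"
proof -
  obtain g where g: "\<And>z. z \<in> \<D> \<Longrightarrow> (g has_field_derivative f z) (at z within \<D>)"
    using holomorphic_convex_primitive'[OF _ _ assms] by auto
  have g': "((\<lambda>z. g z - g 0) has_field_derivative f z) (at z)" if "z \<in> \<D>" for z
    using g[OF that] that by (auto intro!: derivative_eq_intros simp: at_within_open[of z \<D>])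
  moreover from this have "(\<lambda>z. g z - g 0) holomorphic_on \<D>"
    by (subst holomorphic_on_open) blast+
  ultimately show ?thesis using that by simp
qed

text \<open>At a zero \<open>z\<close> of \<^term>\<open>Re q\<close> of least modulus, \<^term>\<open>z * deriv q z\<close> is a nonpositive real:
  the tangential derivative of \<^term>\<open>Re q\<close> vanishes and the radial one is not positive.\<close>

lemma Re_pos_propagation:
  assumes q: "q holomorphic_on \<D>" and q0: "Re (q 0) > 0"
    and step: "\<And>z. \<lbrakk>z \<in> \<D>; Re (q z) = 0; Im (z * deriv q z) = 0; Re (z * deriv q z) \<le> 0\<rbrakk> \<Longrightarrow> False"
    and z: "z \<in> \<D>"
  shows "Re (q z) > 0"
proof (rule ccontr)
  assume neg: "\<not> Re (q z) > 0"
  define r where "r = cmod z"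
  have r1: "r < 1" using z by (simp add: r_def)
  define S where "S = {w \<in> cball 0 r. Re (q w) \<le> 0}"
  have sub: "cball 0 r \<subseteq> \<D>" using r1 by auto
  have cont: "continuous_on (cball 0 r) (\<lambda>w. Re (q w))"
    by (intro continuous_intros continuous_on_subset[OF holomorphic_on_imp_continuous_on[OF q] sub])
  have "closed S"
    unfolding S_def using cont by (intro continuous_on_closed_Collect_le continuous_on_const) auto
  then have "compact S"
    using compact_Int_closed[of "cball 0 r" S] by (auto simp: S_def Int_def intro: back_subst[of compact])
  moreover have "z \<in> S" using neg by (simp add: S_def r_def)
  ultimately obtain w where w: "w \<in> S" and min: "\<And>v. v \<in> S \<Longrightarrow> cmod w \<le> cmod v"
    using continuous_attains_inf[of S cmod] continuous_on_norm_id by blast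
  have wD: "w \<in> \<D>" using w sub by (auto simp: S_def)
  have w0: "w \<noteq> 0" using w q0 by (auto simp: S_def)
  have inside: "Re (q v) > 0" if "cmod v < cmod w" for v
    using min[of v] that w by (force simp: S_def)
  have dq: "(q has_field_derivative deriv q v) (at v)" if "v \<in> \<D>" for v
    using q that by (intro holomorphic_derivI[of _ \<D>]) auto
  have ray: "((\<lambda>t::real. Re (q (of_real t * v))) has_real_derivative Re (v * deriv q v)) (at 1)"
    if "v \<in> \<D>" for v
  proof (intro has_field_derivative_Re has_vector_derivative_real_field)
    have "((\<lambda>z. z * v) has_field_derivative v) (at (of_real 1))"
      by (auto intro!: derivative_eq_intros)
    then show "((\<lambda>z. q (z * v)) has_field_derivative v * deriv q v) (at (of_real 1))"
      using DERIV_chain2[of q "deriv q v" "\<lambda>z. z * v" "of_real 1"] dq[OF that]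
      by (simp add: mult.commute)
  qed
  \<comment> \<open>Minimality gives positivity only strictly inside the circle through
    \<open>w\<close>. Limits along radii carry the weak inequality to the circle itself, where the
    tangential argument takes place.\<close>
  have nonneg: "Re (q v) \<ge> 0" if v: "cmod v \<le> cmod w" for v
  proof -
    have "v \<in> \<D>" using v wD by simp
    from DERIV_isCont[OF ray[OF this]]
    have "((\<lambda>t::real. Re (q (of_real t * v))) \<longlongrightarrow> Re (q v)) (at_left 1)"
      by (auto simp: isCont_def intro: filterlim_mono[OF _ order_refl at_le])
    moreover have "\<forall>\<^sub>F t::real in at_left 1. 0 \<le> Re (q (of_real t * v))"
      using eventually_at_left_real[OF zero_less_one]
    proof (eventually_elim, goal_cases)
      case (1 t)
      then have "t * cmod v \<le> t * cmod w" "t * cmod w < 1 * cmod w"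
        using v w0 by (auto intro!: mult_left_mono)
      moreover have "cmod (of_real t * v) = t * cmod v"
        using 1 by (simp add: norm_mult)
      ultimately have "cmod (of_real t * v) < cmod w"
        by linarith
      then show ?case using inside by (simp add: less_imp_le)
    qed
    ultimately show ?thesis
      by (rule tendsto_lowerbound) simp
  qed
  have Re0: "Re (q w) = 0"
    using nonneg[of w] w by (simp add: S_def)
  have "Re (w * deriv q w) \<le> 0"
  proof (rule ccontr)
    assume "\<not> Re (w * deriv q w) \<le> 0"
    then obtain d where d: "d > 0" "\<And>h. \<lbrakk>0 < h; h < d\<rbrakk> \<Longrightarrow> Re (q (of_real (1 - h) * w)) < Re (q (of_real 1 * w))"
      using DERIV_pos_inc_left[OF ray[OF wD]] by (auto simp: not_le)
    define h where "h = min (d / 2) (1 / 2)"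
    have h: "0 < h" "h < d" "h \<le> 1 / 2" using d(1) by (auto simp: h_def)
    have "cmod (of_real (1 - h) * w) = (1 - h) * cmod w"
      using h by (simp only: norm_mult norm_of_real)
    also have "\<dots> \<le> 1 * cmod w" using h by (intro mult_right_mono) auto
    finally show False using nonneg[of "of_real (1 - h) * w"] d(2)[OF h(1,2)] Re0 by simp
  qed
  moreover have "Im (w * deriv q w) = 0"
  proof -
    have "((\<lambda>z. w * exp (\<i> * z)) has_field_derivative w * \<i>) (at (of_real 0))"
      by (auto intro!: derivative_eq_intros)
    then have "((\<lambda>z. q (w * exp (\<i> * z))) has_field_derivative deriv q w * (w * \<i>)) (at (of_real 0))"
      using DERIV_chain2[of q "deriv q w" "\<lambda>z. w * exp (\<i> * z)" "of_real 0"] dq[OF wD] by simp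
    then have "((\<lambda>t::real. Re (q (w * exp (\<i> * of_real t)))) has_real_derivative
        Re (deriv q w * (w * \<i>))) (at 0)"
      by (intro has_field_derivative_Re has_vector_derivative_real_field)
    then have "Re (deriv q w * (w * \<i>)) = 0"
      by (rule DERIV_local_min[of _ _ _ 1]) (use Re0 in \<open>auto intro!: nonneg simp: norm_mult\<close>)
    then show ?thesis by (simp add: algebra_simps)
  qed
  ultimately show False using step wD Re0 by blast
qed

text \<open>The reciprocal \<open>q = f / (z f')\<close> of the starlikeness quotient is holomorphic
  without any knowledge of the zeros of \<open>f\<close>. It satisfies the linear equation
  \<open>z q' + q p = 1\<close>, where \<open>p\<close> is the convexity quotient. At a contact
  point \<open>q\<close> is imaginary and \<open>z q'\<close> is real, so the imaginary part gives
  \<open>q = 0\<close> and then \<open>z q' = 1\<close>, contradicting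
  \<open>z q' \<le> 0\<close>.\<close>

lemma convex_imp_Re_quotient_pos:
  assumes f: "f holomorphic_on \<D>" "f 0 = 0" and nz: "\<And>z. z \<in> \<D> \<Longrightarrow> deriv f z \<noteq> 0"
    and P: "\<And>z. z \<in> \<D> \<Longrightarrow> Re (1 + z * deriv (deriv f) z / deriv f z) > 0"
  obtains g where "g holomorphic_on \<D>" "\<And>z. z \<in> \<D> \<Longrightarrow> f z = z * g z"
    "\<And>z. z \<in> \<D> \<Longrightarrow> Re (g z / deriv f z) > 0"
proof -
  obtain g where g: "g holomorphic_on \<D>" "\<And>z. z \<in> \<D> \<Longrightarrow> f z = z * g z" and g0: "deriv f 0 = g 0"
    using Schwarz3[OF f] by (metis mem_ball_0)
  have f': "deriv f holomorphic_on \<D>" using f by (intro holomorphic_intros) auto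
  have dg: "(g has_field_derivative deriv g z) (at z)" if "z \<in> \<D>" for z
    using g that by (intro holomorphic_derivI[of _ \<D>]) auto
  have df': "(deriv f has_field_derivative deriv (deriv f) z) (at z)" if "z \<in> \<D>" for z
    using f' that by (intro holomorphic_derivI[of _ \<D>]) auto
  define q where "q = (\<lambda>z. g z / deriv f z)"
  have q: "q holomorphic_on \<D>"
    unfolding q_def by (intro holomorphic_intros g f' nz)
  have ode: "z * deriv q z + q z * (1 + z * deriv (deriv f) z / deriv f z) = 1" if z: "z \<in> \<D>" for z
  proof -
    have "((\<lambda>z. z * g z) has_field_derivative g z + z * deriv g z) (at z)"
      using dg[OF z] by (auto intro!: derivative_eq_intros)
    then have "(f has_field_derivative g z + z * deriv g z) (at z)"
      by (rule has_field_derivative_transform_within_open[of _ _ _ \<D>]) (use z g in auto)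
    then have "deriv f z = g z + z * deriv g z"
      by (rule DERIV_imp_deriv)
    moreover have "(q has_field_derivative
        (deriv g z * deriv f z - g z * deriv (deriv f) z) / (deriv f z * deriv f z)) (at z)"
      unfolding q_def by (intro DERIV_divide dg df' nz z)
    then have "deriv q z = (deriv g z * deriv f z - g z * deriv (deriv f) z) / (deriv f z * deriv f z)"
      by (rule DERIV_imp_deriv)
    moreover have "z * ((g' * d - v * d') / (d * d)) + v / d * (1 + z * d' / d) = 1"
      if "d = v + z * g'" "d \<noteq> 0" for v g' d d' :: complex
    proof -
      have "z * ((g' * d - v * d') / (d * d)) + v / d * (1 + z * d' / d) = (v + z * g') / d"
        using that(2) by (simp add: divide_simps) (simp add: algebra_simps)
      then show ?thesis using that by simp
    qed
    ultimately show ?thesis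
      using nz[OF z] by (simp only: q_def)
  qed
  have "Re (q z) > 0" if "z \<in> \<D>" for z
  proof (rule Re_pos_propagation[OF q _ _ that])
    show "Re (q 0) > 0" using nz[of 0] g0 by (simp add: q_def)
  next
    fix z assume z: "z \<in> \<D>" and q: "Re (q z) = 0"
      and im: "Im (z * deriv q z) = 0" and re: "Re (z * deriv q z) \<le> 0"
    define p where "p = 1 + z * deriv (deriv f) z / deriv f z"
    have p: "Re p > 0" using P[OF z] by (simp only: p_def)
    have eq: "z * deriv q z + q z * p = 1" using ode[OF z] by (simp only: p_def)
    have "Im (q z) * Re p = 0"
      using arg_cong[OF eq, of Im] im q by simp
    then have "q z = 0" using p q by (simp add: complex_eq_iff)
    then show False using arg_cong[OF eq, of Re] re by simp
  qed
  then show ?thesis using that g unfolding q_def by blast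
qed

text \<open>In the coordinate \<open>w = log z\<close>, starlikeness says that \<open>log \<circ> f \<circ> exp\<close> has a derivative
  with positive real part on a half-plane, so it is injective there (Noshiro--Warschawski).\<close>

lemma starlike_imp_inj:
  assumes g: "g holomorphic_on \<D>" and f: "\<And>z. z \<in> \<D> \<Longrightarrow> f z = z * g z"
    and nz: "\<And>z. z \<in> \<D> \<Longrightarrow> g z \<noteq> 0"
    and P: "\<And>z. z \<in> \<D> \<Longrightarrow> Re (deriv f z / g z) > 0"
  shows "inj_on f \<D>"
proof -
  obtain h where h: "h holomorphic_on \<D>" and gh: "\<And>z. z \<in> \<D> \<Longrightarrow> g z = exp (h z)"
    using contractible_imp_holomorphic_log[OF g _ nz] convex_imp_contractible convex_ball by metis
  have dh: "(h has_field_derivative deriv h z) (at z)" if "z \<in> \<D>" for z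
    using h that by (intro holomorphic_derivI[of _ \<D>]) auto
  have df: "deriv f z / g z = 1 + z * deriv h z" if z: "z \<in> \<D>" for z
  proof -
    have "((\<lambda>z. z * exp (h z)) has_field_derivative exp (h z) + z * (exp (h z) * deriv h z)) (at z)"
      using dh[OF z] by (auto intro!: derivative_eq_intros)
    then have "(f has_field_derivative exp (h z) + z * (exp (h z) * deriv h z)) (at z)"
      by (rule has_field_derivative_transform_within_open[of _ _ _ \<D>]) (use z f gh in auto)
    then have "deriv f z = exp (h z) + z * (exp (h z) * deriv h z)"
      by (rule DERIV_imp_deriv)
    then show ?thesis using gh[OF z] by (simp add: field_simps)
  qed
  \<comment> \<open>A single-valued lift: \<open>exp (G w) = f (exp w)\<close> for
    \<open>Re w < 0\<close>.\<close>
  define G where "G = (\<lambda>w. w + h (exp w))"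
  have eD: "exp w \<in> \<D>" if "Re w < 0" for w :: complex
    using that by simp
  have dG: "(G has_field_derivative deriv f (exp w) / g (exp w)) (at w)" if "Re w < 0" for w
    unfolding G_def df[OF eD[OF that]] using dh[OF eD[OF that]]
    by (auto intro!: derivative_eq_intros DERIV_chain2[of h] simp: mult.commute)
  have injG: "w = v" if w: "Re w < 0" and v: "Re v < 0" and eq: "G w = G v" for w v
  proof (rule ccontr)
    assume ne: "w \<noteq> v"
    have seg: "Re u < 0" if "u \<in> closed_segment w v" for u
    proof -
      have "closed_segment w v \<subseteq> {z. Re z < 0}"
        using w v by (intro closed_segment_subset convex_halfspace_Re_lt) auto
      then show ?thesis using that by auto
    qed
    \<comment> \<open>Dividing \<open>G\<close> by \<open>v - w\<close> makes the mean value theorem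
      for real parts speak of the real part of the derivative of \<open>G\<close> itself.\<close>
    obtain u where u: "u \<in> closed_segment w v" and
      mvt: "Re (G v / (v - w)) - Re (G w / (v - w))
          = Re ((deriv f (exp u) / g (exp u)) / (v - w) * (v - w))"
      using complex_mvt_line[of w v "\<lambda>z. G z / (v - w)" "\<lambda>u. (deriv f (exp u) / g (exp u)) / (v - w)"]
        DERIV_cdivide[OF dG[OF seg]] by blast
    have "Re (deriv f (exp u) / g (exp u)) = 0"
      using mvt ne eq by simp
    then show False using P[OF eD[OF seg[OF u]]] by simp
  qed
  \<comment> \<open>Equal values of \<open>exp \<circ> G\<close> determine \<open>G\<close> only up
    to a multiple of \<open>2 * pi * \<i>\<close>; this moves the multiple into the argument, so
    that \<open>injG\<close> applies.\<close>
  have per: "G (w + of_real (of_int (2 * k) * pi) * \<i>) = G w + of_real (of_int (2 * k) * pi) * \<i>" for w k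
  proof -
    have "exp (w + of_real (of_int (2 * k) * pi) * \<i>) = exp w"
      unfolding exp_eq by blast
    then show ?thesis by (simp only: G_def add_ac)
  qed
  show ?thesis
  proof (rule inj_onI)
    fix z1 z2 assume z: "z1 \<in> \<D>" "z2 \<in> \<D>" and eq: "f z1 = f z2"
    show "z1 = z2"
    proof (cases "z1 = 0 \<or> z2 = 0")
      case True
      then show ?thesis using eq z f nz by auto
    next
      case False
      then have Re: "Re (Ln z1) < 0" "Re (Ln z2) < 0" and e: "exp (Ln z1) = z1" "exp (Ln z2) = z2"
        using z by auto
      have "exp (G (Ln z)) = f z" if "z \<in> \<D>" "z \<noteq> 0" for z
        using that f gh by (simp add: G_def exp_add)
      then have "exp (G (Ln z1)) = exp (G (Ln z2))"
        using False eq z by simp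
      then obtain k where k: "G (Ln z1) = G (Ln z2) + of_real (of_int (2 * k) * pi) * \<i>"
        unfolding exp_eq by blast
      have "Ln z1 = Ln z2 + of_real (of_int (2 * k) * pi) * \<i>"
      proof (rule injG)
        show "Re (Ln z2 + of_real (of_int (2 * k) * pi) * \<i>) < 0"
          using Re by simp
      qed (simp_all only: Re k per)
      then have "exp (Ln z1) = exp (Ln z2)"
        unfolding exp_eq by blast
      then show ?thesis by (simp only: e)
    qed
  qed
qed

lemma convex_imp_inj:
  assumes f: "f holomorphic_on \<D>" "f 0 = 0" and nz: "\<And>z. z \<in> \<D> \<Longrightarrow> deriv f z \<noteq> 0"
    and P: "\<And>z. z \<in> \<D> \<Longrightarrow> Re (1 + z * deriv (deriv f) z / deriv f z) > 0"
  shows "inj_on f \<D>"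
proof -
  obtain g where g: "g holomorphic_on \<D>" "\<And>z. z \<in> \<D> \<Longrightarrow> f z = z * g z"
    and pos: "\<And>z. z \<in> \<D> \<Longrightarrow> Re (g z / deriv f z) > 0"
    using convex_imp_Re_quotient_pos[OF assms] by blast
  show ?thesis
  proof (rule starlike_imp_inj[OF g])
    fix z assume z: "z \<in> \<D>"
    show "g z \<noteq> 0" using pos[OF z] by auto
    have "Re (inverse (g z / deriv f z)) > 0"
      unfolding inverse_complex.sel using pos[OF z] by (intro divide_pos_pos add_pos_nonneg) auto
    then show "Re (deriv f z / g z) > 0" by simp
  qed
qed

text \<open>The equation says that \<open>log f'\<close> has derivative
  \<open>(\<phi> (\<omega> z) - 1) / z\<close>, whose singularity at 0 is removable. One integration
  gives \<open>H = log f'\<close>, a second gives \<open>f\<close>, and \<open>H 0 = 0\<close>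
  yields the normalisation.\<close>

lemma exists_convex_function:
  assumes \<phi>: "\<phi> holomorphic_on \<D>" "\<phi> 0 = 1" and Re: "\<And>z. z \<in> \<D> \<Longrightarrow> Re (\<phi> z) > 0"
    and \<omega>: "schwarz_function \<omega>"
  obtains f where "f \<in> class_S" "\<forall>z\<in>\<D>. 1 + z * deriv (deriv f) z / deriv f z = \<phi> (\<omega> z)"
proof -
  have \<omega>': "\<omega> holomorphic_on \<D>" "\<omega> 0 = 0" "\<And>z. z \<in> \<D> \<Longrightarrow> \<omega> z \<in> \<D>"
    using \<omega> unfolding schwarz_function_def by blast+
  have "(\<phi> \<circ> \<omega>) holomorphic_on \<D>"
    by (intro holomorphic_on_compose_gen[OF \<omega>'(1) \<phi>(1)]) (use \<omega>' in auto)
  then have "(\<lambda>z. \<phi> (\<omega> z) - 1) holomorphic_on \<D>"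
    by (intro holomorphic_intros) (simp add: o_def)
  then obtain k where k: "k holomorphic_on \<D>" "\<And>z. cmod z < 1 \<Longrightarrow> \<phi> (\<omega> z) - 1 = z * k z"
    using Schwarz3[of "\<lambda>z. \<phi> (\<omega> z) - 1" 1] \<omega>'(2) \<phi>(2) by auto
  obtain H where H: "H holomorphic_on \<D>" "H 0 = 0"
      "\<And>z. z \<in> \<D> \<Longrightarrow> (H has_field_derivative k z) (at z)"
    using holomorphic_primitive_disc[OF k(1)] by blast
  obtain f where f: "f holomorphic_on \<D>" "f 0 = 0"
      "\<And>z. z \<in> \<D> \<Longrightarrow> (f has_field_derivative exp (H z)) (at z)"
    using holomorphic_primitive_disc[of "\<lambda>z. exp (H z)"] H(1) by (auto intro: holomorphic_intros)
  have f': "deriv f z = exp (H z)" if "z \<in> \<D>" for z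
    using f(3)[OF that] by (rule DERIV_imp_deriv)
  have f'': "deriv (deriv f) z = exp (H z) * k z" if z: "z \<in> \<D>" for z
  proof (rule DERIV_imp_deriv)
    have "((\<lambda>z. exp (H z)) has_field_derivative exp (H z) * k z) (at z)"
      using H(3)[OF z] by (auto intro!: derivative_eq_intros)
    then show "(deriv f has_field_derivative exp (H z) * k z) (at z)"
      by (rule has_field_derivative_transform_within_open[of _ _ _ \<D>]) (use z f' in auto)
  qed
  have P: "1 + z * deriv (deriv f) z / deriv f z = \<phi> (\<omega> z)" if "z \<in> \<D>" for z
    using k(2)[of z] that by (simp add: f' f'' algebra_simps)
  have "inj_on f \<D>"
  proof (rule convex_imp_inj[OF f(1,2)])
    fix z assume "z \<in> \<D>"
    then show "deriv f z \<noteq> 0" "Re (1 + z * deriv (deriv f) z / deriv f z) > 0"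
      using Re[OF \<omega>'(3)] by (simp_all only: P) (simp add: f')
  qed
  then have "f \<in> class_S"
    using f f'[of 0] H(2) by (simp add: class_S_def)
  then show ?thesis using P that by blast
qed

section \<open>The Toeplitz determinant\<close>

text \<open>The matrix commutes with reversal of coordinates. The antisymmetric vector
  \<open>(1, 0, -1)\<close> has eigenvalue \<open>a\<^sub>2 - a\<^sub>4\<close>, and the other
  factor is the determinant on the symmetric vectors.\<close>

lemma toeplitz_3_2_factor:
  "toeplitz_3_2 f = (taylor_coeff f 2 - taylor_coeff f 4)
     * ((taylor_coeff f 2)\<^sup>2 - 2 * (taylor_coeff f 3)\<^sup>2 + taylor_coeff f 2 * taylor_coeff f 4)"
  unfolding toeplitz_3_2_def Let_def det_3 vector_3 by algebra

lemma fps_compose_nth_upto_3: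
  fixes F W :: "'a::comm_ring_1 fps"
  assumes "fps_nth W 0 = 0"
  shows "fps_nth (F oo W) 1 = fps_nth F 1 * fps_nth W 1"
    and "fps_nth (F oo W) 2 = fps_nth F 1 * fps_nth W 2 + fps_nth F 2 * (fps_nth W 1)\<^sup>2"
    and "fps_nth (F oo W) 3 = fps_nth F 1 * fps_nth W 3 + 2 * fps_nth F 2 * fps_nth W 1 * fps_nth W 2
           + fps_nth F 3 * fps_nth W 1 ^ 3"
  using assms
  by (simp_all add: fps_compose_nth fps_mult_nth numeral_2_eq_2 numeral_3_eq_3 algebra_simps)

text \<open>Coefficients are compared in \<open>z f'' = f' (\<phi> \<circ> \<omega> - 1)\<close>. In
  degree \<open>n\<close> the left side is \<open>n * (n + 1)\<close> times coefficient
  \<open>n + 1\<close> of \<open>f\<close>, while the right side involves only earlier ones because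
  \<open>\<phi> \<circ> \<omega> - 1\<close> has no constant term.\<close>

lemma convex_class_coeffs:
  assumes \<phi>: "\<phi> holomorphic_on \<D>" "\<phi> 0 = 1" and f: "f \<in> class_S" and \<omega>: "schwarz_function \<omega>"
    and sub: "\<forall>z\<in>\<D>. 1 + z * deriv (deriv f) z / deriv f z = \<phi> (\<omega> z)"
    and B: "b1 = taylor_coeff \<phi> 1" "b2 = taylor_coeff \<phi> 2" "b3 = taylor_coeff \<phi> 3"
    and c: "c1 = taylor_coeff \<omega> 1" "c2 = taylor_coeff \<omega> 2" "c3 = taylor_coeff \<omega> 3"
  shows "taylor_coeff f 2 = b1 * c1 / 2"
    and "taylor_coeff f 3 = (b1 * c2 + (b2 + b1\<^sup>2) * c1\<^sup>2) / 6"
    and "taylor_coeff f 4 = (2 * b1 * c3 + (3 * b1\<^sup>2 + 4 * b2) * c1 * c2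
           + (b1 ^ 3 + 3 * b1 * b2 + 2 * b3) * c1 ^ 3) / 24"
proof -
  define F \<Phi> W where "F = fps_expansion f 0" and "\<Phi> = fps_expansion \<phi> 0" and "W = fps_expansion \<omega> 0"
  have fS: "f holomorphic_on \<D>" "inj_on f \<D>" "deriv f 0 = 1"
    using f by (auto simp: class_S_def)
  have \<omega>': "\<omega> holomorphic_on \<D>" "\<omega> 0 = 0"
    using \<omega> by (auto simp: schwarz_function_def)
  have F: "f has_fps_expansion F" and \<Phi>: "\<phi> has_fps_expansion \<Phi>" and W: "\<omega> has_fps_expansion W"
    unfolding F_def \<Phi>_def W_def by (intro has_fps_expansion_on_disc fS \<phi> \<omega>')+
  have W0: "fps_nth W 0 = 0"
    using has_fps_expansion_imp_0_eq_fps_nth_0[OF W] \<omega>'(2) by simp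
  have \<Phi>0: "fps_nth \<Phi> 0 = 1"
    using has_fps_expansion_imp_0_eq_fps_nth_0[OF \<Phi>] \<phi>(2) by simp
  have F1: "fps_nth F 1 = 1"
    using has_fps_expansion_imp_0_eq_fps_nth_0[OF has_fps_expansion_deriv[OF F]] fS(3) by simp
  have eq: "fps_X * fps_deriv (fps_deriv F) = fps_deriv F * ((\<Phi> oo W) - 1)"
  proof (rule fps_expansion_unique_on_disc)
    show "(\<lambda>z. z * deriv (deriv f) z) has_fps_expansion fps_X * fps_deriv (fps_deriv F)"
      by (intro fps_expansion_intros F)
    show "(\<lambda>z. deriv f z * ((\<phi> \<circ> \<omega>) z - 1)) has_fps_expansion fps_deriv F * ((\<Phi> oo W) - 1)"
      by (intro has_fps_expansion_mult has_fps_expansion_deriv has_fps_expansion_diff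
          has_fps_expansion_compose has_fps_expansion_1 F \<Phi> W W0)
    fix z assume z: "z \<in> \<D>"
    \<comment> \<open>Univalence of \<open>f\<close> is what permits clearing the
      denominator.\<close>
    have "deriv f z \<noteq> 0"
      by (rule holomorphic_injective_imp_regular[OF fS(1) _ fS(2) z]) simp
    then show "z * deriv (deriv f) z = deriv f z * ((\<phi> \<circ> \<omega>) z - 1)"
      using bspec[OF sub z, symmetric] by simp
  qed
  note comp = fps_compose_nth_upto_3[OF W0, of \<Phi>, folded B[folded \<Phi>_def] c[folded W_def]]
  have comp0: "fps_nth (\<Phi> oo W) 0 = 1"
    by (simp add: \<Phi>0)
  have "2 * fps_nth F 2 = b1 * c1"
    using arg_cong[OF eq, of "\<lambda>F. fps_nth F 1"] F1 comp comp0
    by (simp add: fps_mult_nth numeral_2_eq_2)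
  then show a2: "taylor_coeff f 2 = b1 * c1 / 2"
    unfolding F_def[symmetric] by (simp add: field_simps)
  have "6 * fps_nth F 3 = b1 * c2 + b2 * c1\<^sup>2 + 2 * fps_nth F 2 * (b1 * c1)"
    using arg_cong[OF eq, of "\<lambda>F. fps_nth F 2"] F1 comp comp0
    by (simp add: fps_mult_nth numeral_2_eq_2 numeral_3_eq_3)
  then show a3: "taylor_coeff f 3 = (b1 * c2 + (b2 + b1\<^sup>2) * c1\<^sup>2) / 6"
    using a2 unfolding F_def[symmetric] by (simp add: field_simps power2_eq_square)
  have "12 * fps_nth F 4 = b1 * c3 + 2 * b2 * c1 * c2 + b3 * c1 ^ 3
      + 2 * fps_nth F 2 * (b1 * c2 + b2 * c1\<^sup>2) + 3 * fps_nth F 3 * (b1 * c1)"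
    using arg_cong[OF eq, of "\<lambda>F. fps_nth F 3"] F1 comp comp0
    by (simp add: fps_mult_nth numeral_2_eq_2 numeral_3_eq_3 eval_nat_numeral)
  then show "taylor_coeff f 4 = (2 * b1 * c3 + (3 * b1\<^sup>2 + 4 * b2) * c1 * c2
           + (b1 ^ 3 + 3 * b1 * b2 + 2 * b3) * c1 ^ 3) / 24"
    using a2 a3 unfolding F_def[symmetric] by (simp add: field_simps) algebra
qed

theorem theorem3p2:
  fixes \<phi> :: "complex \<Rightarrow> complex" and B1 B2 B3 q1 q2 bound :: real
  assumes "ma_minda \<phi>"
    and "B1 = mm_coeff \<phi> 1" and "B2 = mm_coeff \<phi> 2" and "B3 = mm_coeff \<phi> 3"
    and "16 * B1^2 - 4 * B1 * B2 \<le> 7 * B1^3"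
    and "7 * B1^3 \<le> 5 * B1^4 + 2 * B1^2 - 4 * B1 * B2 + 7 * B1^2 * B2 + 8 * B2^2 - 6 * B1 * B3"
    and "q1 = (3 * B1^2 + 4 * B2) / (2 * B1)"
    and "q2 = (B1^3 + 3 * B1 * B2 + 2 * B3) / (2 * B1)"
    and "(q1, q2) \<in> D1 \<union> D2 \<union> D3"
    and "bound = 1/144 * (B1 / 2 + (B1^3 + 3 * B1 * B2 + 2 * B3) / 24) *
                 (5 * B1^4 + 36 * B1^2 + 7 * B1^2 * B2 + 8 * B2^2 - 6 * B1 * B3)"
  shows "(\<forall>f \<in> class_C \<phi>. cmod (toeplitz_3_2 f) \<le> bound) \<and>
         (\<exists>f \<in> class_C \<phi>. cmod (toeplitz_3_2 f) = bound)"
proof -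
  have \<phi>: "\<phi> holomorphic_on \<D>" "\<phi> 0 = 1" "\<And>z. z \<in> \<D> \<Longrightarrow> Re (\<phi> z) > 0" "Re (deriv \<phi> 0) > 0"
    using assms(1) by (auto simp: ma_minda_def)
  have coeff: "of_real B1 = taylor_coeff \<phi> 1" "of_real B2 = taylor_coeff \<phi> 2"
      "of_real B3 = taylor_coeff \<phi> 3"
    using ma_minda_coeff_real[OF assms(1)] assms(2-4) by simp_all
  have B1: "B1 > 0"
    using \<phi>(4) assms(2) by (simp add: mm_coeff_def fps_expansion_def)
  \<comment> \<open>All three regions lie in the upper half-plane. The sign makes the first factor
    of \<open>bound\<close> nonnegative, as needed both for multiplying the estimates and for the
    modulus of the extremal value.\<close>
  have q2: "q2 \<ge> 0"
  proof -
    consider "1 \<le> q2" | "1/12 * (q1\<^sup>2 + 8) \<le> q2" | "4 \<le> \<bar>q1\<bar>" "2/3 * (\<bar>q1\<bar> - 1) \<le> q2"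
      using assms(9) unfolding D1_def D2_def D3_def by blast
    then show ?thesis
    proof cases
      case 2
      have "0 \<le> 1/12 * (q1\<^sup>2 + 8)" by simp
      with 2 show ?thesis by (rule order_trans[rotated])
    next
      case 3
      then have "0 \<le> 2/3 * (\<bar>q1\<bar> - 1)" by simp
      with 3(2) show ?thesis by (rule order_trans[rotated])
    qed simp
  qed
  \<comment> \<open>In these terms the two assumed inequalities become the hypotheses of
    \<open>second_factor_bound\<close>, and the last factor of \<open>bound\<close> is
    \<open>36 * B1^2 + K\<close>.\<close>
  define K L where "K = 5 * B1^4 + 7 * B1^2 * B2 + 8 * B2^2 - 6 * B1 * B3"
    and "L = 7 * B1^3 + 4 * B1 * B2"
  have L: "16 * B1\<^sup>2 \<le> L" and K: "L \<le> K + 2 * B1\<^sup>2"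
    using assms(5,6) by (simp_all add: K_def L_def)
  have K0: "0 \<le> 36 * B1\<^sup>2 + K"
    using L K zero_le_power2[of B1] by linarith
  have Bq: "3 * B1\<^sup>2 + 4 * B2 = 2 * B1 * q1" "B1^3 + 3 * B1 * B2 + 2 * B3 = 2 * B1 * q2"
    using B1 assms(7,8) by simp_all
  have bound: "bound = (B1 / 2 + B1 * q2 / 12) * ((36 * B1\<^sup>2 + K) / 144)"
    unfolding assms(10) Bq K_def by (simp add: algebra_simps)
  \<comment> \<open>\<open>?A\<close> is the factor \<open>a\<^sub>2 - a\<^sub>4\<close>, and
    \<open>?S\<close> is 144 times the other factor.\<close>
  let ?A = "\<lambda>c1 c2 c3. of_real (B1 / 2) * c1 - of_real (B1 / 12) * (c3 + of_real q1 * c1 * c2 + of_real q2 * c1^3)"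
  let ?S = "\<lambda>c1 c2 c3. of_real (36 * B1\<^sup>2) * c1\<^sup>2 - of_real K * c1^4 - of_real L * c1\<^sup>2 * c2
           - of_real (8 * B1\<^sup>2) * c2\<^sup>2 + of_real (6 * B1\<^sup>2) * c1 * c3"
  have toeplitz: "toeplitz_3_2 f = ?A c1 c2 c3 * (?S c1 c2 c3 / 144)"
    if f: "f \<in> class_S" and \<omega>: "schwarz_function \<omega>"
      and sub: "\<forall>z\<in>\<D>. 1 + z * deriv (deriv f) z / deriv f z = \<phi> (\<omega> z)"
      and c: "c1 = taylor_coeff \<omega> 1" "c2 = taylor_coeff \<omega> 2" "c3 = taylor_coeff \<omega> 3"
    for f \<omega> c1 c2 c3
  proof -
    note a = convex_class_coeffs[OF \<phi>(1,2) f \<omega> sub coeff c]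
    have "taylor_coeff f 2 - taylor_coeff f 4 = ?A c1 c2 c3"
    proof -
      have Bq': "3 * (of_real B1)\<^sup>2 + 4 * of_real B2 = (2 * of_real B1 * of_real q1 :: complex)"
        "of_real B1 ^ 3 + 3 * of_real B1 * of_real B2 + 2 * of_real B3
          = (2 * of_real B1 * of_real q2 :: complex)"
        using arg_cong[OF Bq(1), of complex_of_real] arg_cong[OF Bq(2), of complex_of_real] by simp_all
      show ?thesis unfolding a(1,3) Bq' by (simp add: field_simps)
    qed
    moreover have "(taylor_coeff f 2)\<^sup>2 - 2 * (taylor_coeff f 3)\<^sup>2 + taylor_coeff f 2 * taylor_coeff f 4
        = ?S c1 c2 c3 / 144"
      unfolding a K_def L_def by (simp add: field_simps) algebra
    ultimately show ?thesis unfolding toeplitz_3_2_factor by simp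
  qed
  have upper: "cmod (toeplitz_3_2 f) \<le> bound" if "f \<in> class_C \<phi>" for f
  proof -
    from that obtain \<omega> where f: "f \<in> class_S" and \<omega>: "schwarz_function \<omega>"
      and sub: "\<forall>z\<in>\<D>. 1 + z * deriv (deriv f) z / deriv f z = \<phi> (\<omega> z)"
      by (auto simp: class_C_def subordinate_def)
    define c1 c2 c3 where c: "c1 = taylor_coeff \<omega> 1" "c2 = taylor_coeff \<omega> 2" "c3 = taylor_coeff \<omega> 3"
    obtain \<zeta> \<kappa> where schur: "cmod c1 \<le> 1" "cmod \<zeta> \<le> 1" "cmod \<kappa> \<le> 1 - (cmod \<zeta>)\<^sup>2"
      "c2 = of_real (1 - (cmod c1)\<^sup>2) * \<zeta>"
      "c3 = of_real (1 - (cmod c1)\<^sup>2) * (\<kappa> - cnj c1 * \<zeta>\<^sup>2)"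
      using schwarz_function_coeffs[OF \<omega>] unfolding c by metis
    have "cmod (?A c1 c2 c3) \<le> cmod (of_real (B1 / 2) * c1)
        + cmod (of_real (B1 / 12) * (c3 + of_real q1 * c1 * c2 + of_real q2 * c1^3))"
      by (rule norm_triangle_ineq4)
    also have "\<dots> \<le> B1 / 2 * 1 + B1 / 12 * q2"
      unfolding norm_mult[of "of_real _"] norm_of_real
      using B1 schur(1) prokhorov_szynal[OF schur assms(9)]
      by (intro add_mono mult_mono) auto
    finally have A: "cmod (?A c1 c2 c3) \<le> B1 / 2 + B1 * q2 / 12" by simp
    have "cmod (?S c1 c2 c3) \<le> 36 * B1\<^sup>2 + K"
      by (rule second_factor_bound[OF schur(1) schur_coeff_bounds[OF schur] L K])
    then have "cmod (?S c1 c2 c3 / 144) \<le> (36 * B1\<^sup>2 + K) / 144"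
      unfolding norm_divide by simp
    then show ?thesis
      unfolding toeplitz[OF f \<omega> sub c] bound norm_mult[of "?A c1 c2 c3"]
      using A B1 q2 by (intro mult_mono) auto
  qed
  \<comment> \<open>Here \<open>c1 = \<i>\<close> and \<open>c2 = c3 = 0\<close>. Since
    \<open>\<i>^3 = -\<i>\<close>, the two terms of \<open>?A\<close> reinforce each other; since
    \<open>\<i>^2 = -1\<close> and \<open>\<i>^4 = 1\<close>, so do the \<open>B1^2\<close> and
    \<open>K\<close> terms of \<open>?S\<close>. Both triangle inequalities become
    equalities.\<close>
  define \<omega> :: "complex \<Rightarrow> complex" where "\<omega> = (\<lambda>z. \<i> * z)"
  have \<omega>: "schwarz_function \<omega>"
    by (auto simp: schwarz_function_def \<omega>_def norm_mult intro!: holomorphic_intros)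
  have "\<omega> has_fps_expansion fps_const \<i> * fps_X"
    unfolding \<omega>_def by (intro fps_expansion_intros)
  then have W: "fps_expansion \<omega> 0 = fps_const \<i> * fps_X"
    by (rule fps_expansion_eqI)
  have c: "\<i> = taylor_coeff \<omega> 1" "0 = taylor_coeff \<omega> 2" "0 = taylor_coeff \<omega> 3"
    by (simp_all add: W)
  obtain f where f: "f \<in> class_S"
      and sub: "\<forall>z\<in>\<D>. 1 + z * deriv (deriv f) z / deriv f z = \<phi> (\<omega> z)"
    using exists_convex_function[OF \<phi>(1,2,3) \<omega>] by blast
  have "f \<in> class_C \<phi>"
    using f \<omega> sub by (auto simp: class_C_def subordinate_def)
  moreover have "cmod (toeplitz_3_2 f) = bound"
  proof -
    have "?A \<i> 0 0 = \<i> * of_real (B1 / 2 + B1 * q2 / 12)"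
      by (simp add: power3_eq_cube algebra_simps)
    moreover have "?S \<i> 0 0 = - of_real (36 * B1\<^sup>2 + K)"
      by simp
    ultimately have "cmod (toeplitz_3_2 f)
        = \<bar>B1 / 2 + B1 * q2 / 12\<bar> * (\<bar>36 * B1\<^sup>2 + K\<bar> / 144)"
      unfolding toeplitz[OF f \<omega> sub c] norm_mult norm_divide
      by (simp only: norm_mult norm_minus_cancel norm_of_real norm_ii norm_numeral mult_1)
    then show ?thesis
      unfolding bound using B1 q2 K0 by simp
  qed
  ultimately show ?thesis using upper by blast
qed

end
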